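(* Assume the convexified problem $$\zeta^{LD}=\min_{x,y,z}\Big\{\sum_{s\in\mathcal S}p_s(c^\top x_s+q_s^\top y_s) : (x_s,y_s)\in\mathrm{conv}(K_s),\ x_s=z,\ \forall s\in\mathcal S\Big\}$$ has an optimal solution. Let the FW-PH algorithm (described in the context) be run with $k_{max}=\infty$, $\epsilon=0$, $\alpha\in\mathbb{R}$, $t_{max}\ge 1$, penalty parameter $\rho>0$, and initial multipliers satisfying $\sum_{s\in\mathcal S}p_s\omega_s^0=0$. If either $t_{max}\ge 2$ or $$\bigcap_{s\in\mathcal S}\mathrm{Proj}_x\big(\mathrm{conv}(V_s^0)\big)\neq\emptyset,$$ then $\lim_{k\to\infty}\phi^k=\zeta^{LD}$.
   Context: Setting. $\mathcal S$ is a finite set of scenarios with probabilities $p_s>0$, $\sum_{s\in\mathcal S}p_s=1$. Let $c\in\mathbb{R}^{n_x}$ and $q_s\in\mathbb{R}^{n_y}$. Let $X\subset\mathbb{R}^{n_x}$ and $Y_s\subset\mathbb{R}^{n_y}$ be mixed-integer linear sets (finitely many linear constraints plus integrality restrictions on some components), and let $K_s=\{(x,y): W_sy=h_s-T_sx,\ x\in X,\ y\in Y_s\}$ for given matrices $W_s,T_s$ and vectors $h_s$. Standing assumption: each $\mathrm{conv}(K_s)$ is bounded (so it is a polytope). $\mathcal V(\mathrm{conv}(K_s))$ denotes its set of extreme points. $\mathrm{Proj}_x$ is the projection $(x,y)\mapsto x$. In a block $(x_s,y_s)_{s\in\mathcal S}$, $x_s\in\mathbb{R}^{n_x}$ and $y_s\in\mathbb{R}^{n_y}$,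 and $z\in\mathbb{R}^{n_x}$. For $\rho>0$, $$L_s^\rho(x,y,z,\omega_s)=c^\top x+q_s^\top y+\omega_s^\top(x-z)+\tfrac{\rho}{2}\|x-z\|_2^2 .$$ Procedure SDM$(V_s^0,x_s^0,\omega_s,z,t_{max},\tau)$ for scenario $s$ (its inputs $V_s^0, x_s^0$ are local names), with finite $V_s^0\subset\mathrm{conv}(K_s)$. For $t=1,\dots,t_{max}$: (i) $\widehat\omega_s^t\gets\omega_s+\rho(x_s^{t-1}-z)$; (ii) choose $(\widehat x_s,\widehat y_s)\in\arg\min\{(c+\widehat\omega_s^t)^\top x+q_s^\top y:(x,y)\in\mathcal V(\mathrm{conv}(K_s))\}$; (iii) if $t=1$, set $\phi_s\gets(c+\widehat\omega_s^1)^\top\widehat x_s+q_s^\top\widehat y_s$; (iv) $\Gamma^t\gets-[(c+\widehat\omega_s^t)^\top(\widehat x_s-x_s^{t-1})+q_s^\top(\widehat y_s-y_s^{t-1})]$; (v) $V_s^t\gets V_s^{t-1}\cup\{(\widehat x_s,\widehat y_s)\}$; (vi) choose $(x_s^t,y_s^t)\in\arg\min\{L_s^\rho(x,y,z,\omega_s):(x,y)\in\mathrm{conv}(V_s^t)\}$; (vii) if $\Gamma^t\le\tau$, return $(x_s^t,y_s^t,V_s^t,\phi_s)$. If the loop ends, return $(x_s^{t_{max}},y_s^{t_{max}},V_s^{t_{max}},\phi_s)$. FW-PH algorithm. Inputs: finite sets $V_s^0\subset\mathrm{conv}(K_s)$, points $(x_s^0,y_s^0)_{s\in\mathcal S}$,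 multipliers $\omega^0=(\omega_s^0)_{s\in\mathcal S}$ with $\omega_s^0\in\mathbb{R}^{n_x}$, and parameters $\rho,\alpha,\epsilon,k_{max},t_{max}$. Set $z^0\gets\sum_sp_sx_s^0$ and $\omega_s^1\gets\omega_s^0+\rho(x_s^0-z^0)$. For $k=1,2,\dots,k_{max}$: for each $s\in\mathcal S$, set $\widetilde x_s\gets(1-\alpha)z^{k-1}+\alpha x_s^{k-1}$ and $[x_s^k,y_s^k,V_s^k,\phi_s^k]\gets\mathrm{SDM}(V_s^{k-1},\widetilde x_s,\omega_s^k,z^{k-1},t_{max},0)$ (in step (iv) with $t=1$, the $y$-component of the starting point is $y_s^{k-1}$); then $\phi^k\gets\sum_sp_s\phi_s^k$ and $z^k\gets\sum_sp_sx_s^k$; stop if $\sqrt{\sum_sp_s\|x_s^k-z^{k-1}\|_2^2}<\epsilon$; otherwise $\omega_s^{k+1}\gets\omega_s^k+\rho(x_s^k-z^k)$ for all $s$. (With $\epsilon=0$ the stopping test is never met, so an infinite sequence $(\phi^k)_{k\ge1}$ is produced.) *)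

theory Defs
  imports "HOL-Analysis.Analysis" "HOL-Library.Extended_Nat"
begin

text \<open>Scenarios are the elements of a finite type \<open>'s\<close>; \<open>real ^ 'nx\<close> and \<open>real ^ 'ny\<close> are the
  first- and second-stage spaces.\<close>

definition mixed_integer_linear :: "(real ^ 'n) set \<Rightarrow> bool" where
  "mixed_integer_linear S \<longleftrightarrow>
     (\<exists>(C :: ((real ^ 'n) \<times> real) set) (I :: 'n set). finite C \<and>
        S = {x. (\<forall>(a, b) \<in> C. a \<bullet> x \<le> b) \<and> (\<forall>i \<in> I. x $ i \<in> \<int>)})"

definition scenario_set ::
    "real ^ 'ny ^ 'm \<Rightarrow> real ^ 'nx ^ 'm \<Rightarrow> real ^ 'm \<Rightarrow> (real ^ 'nx) set \<Rightarrow> (real ^ 'ny) set \<Rightarrow>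
     ((real ^ 'nx) \<times> (real ^ 'ny)) set" where
  "scenario_set W T h X Y = {(x, y). W *v y = h - T *v x \<and> x \<in> X \<and> y \<in> Y}"

definition LD_feasible ::
    "('s::finite \<Rightarrow> ((real ^ 'nx) \<times> (real ^ 'ny)) set) \<Rightarrow>
     (('s \<Rightarrow> real ^ 'nx) \<times> ('s \<Rightarrow> real ^ 'ny) \<times> (real ^ 'nx)) set" where
  "LD_feasible K = {(x, y, z). \<forall>s. (x s, y s) \<in> convex hull (K s) \<and> x s = z}"

definition LD_objective ::
    "('s::finite \<Rightarrow> real) \<Rightarrow> real ^ 'nx \<Rightarrow> ('s \<Rightarrow> real ^ 'ny) \<Rightarrow>
     ('s \<Rightarrow> real ^ 'nx) \<times> ('s \<Rightarrow> real ^ 'ny) \<times> (real ^ 'nx) \<Rightarrow> real" where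
  "LD_objective p c q = (\<lambda>(x, y, z). \<Sum>s\<in>UNIV. p s * (c \<bullet> x s + q s \<bullet> y s))"

definition LD_optimal ::
    "('s::finite \<Rightarrow> real) \<Rightarrow> real ^ 'nx \<Rightarrow> ('s \<Rightarrow> real ^ 'ny) \<Rightarrow>
     ('s \<Rightarrow> ((real ^ 'nx) \<times> (real ^ 'ny)) set) \<Rightarrow>
     ('s \<Rightarrow> real ^ 'nx) \<times> ('s \<Rightarrow> real ^ 'ny) \<times> (real ^ 'nx) \<Rightarrow> bool" where
  "LD_optimal p c q K v \<longleftrightarrow> is_arg_min (LD_objective p c q) (\<lambda>u. u \<in> LD_feasible K) v"

text \<open>The infimum below is a minimum as soon as some \<open>v\<close> satisfies \<open>LD_optimal p c q K v\<close>.\<close>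

definition zeta_LD ::
    "('s::finite \<Rightarrow> real) \<Rightarrow> real ^ 'nx \<Rightarrow> ('s \<Rightarrow> real ^ 'ny) \<Rightarrow>
     ('s \<Rightarrow> ((real ^ 'nx) \<times> (real ^ 'ny)) set) \<Rightarrow> real" where
  "zeta_LD p c q K = (INF v\<in>LD_feasible K. LD_objective p c q v)"

definition aug_lagrangian ::
    "real ^ 'nx \<Rightarrow> real ^ 'ny \<Rightarrow> real \<Rightarrow> real ^ 'nx \<Rightarrow> real ^ 'ny \<Rightarrow> real ^ 'nx \<Rightarrow> real ^ 'nx \<Rightarrow> real" where
  "aug_lagrangian c q \<rho> x y z \<omega> =
     c \<bullet> x + q \<bullet> y + \<omega> \<bullet> (x - z) + \<rho> / 2 * (norm (x - z))\<^sup>2"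

text \<open>The argmin choices make the procedure nondeterministic, so it is a relation between its inputs
  \<open>V\<^sub>0, x\<^sub>0, y\<^sub>0, \<omega>, z, t\<^sub>m\<^sub>a\<^sub>x, \<tau>\<close> and a returned tuple \<open>(x', y', V', \<phi>)\<close>. The witness \<open>n\<close> is the
  iteration at which it returns. The starting second-stage point \<open>y\<^sub>0\<close> is used only in
  \<open>\<Gamma> 1\<close>.\<close>

definition SDM ::
    "real ^ 'nx \<Rightarrow> real ^ 'ny \<Rightarrow> real \<Rightarrow> ((real ^ 'nx) \<times> (real ^ 'ny)) set \<Rightarrow>
     ((real ^ 'nx) \<times> (real ^ 'ny)) set \<Rightarrow> real ^ 'nx \<Rightarrow> real ^ 'ny \<Rightarrow> real ^ 'nx \<Rightarrow> real ^ 'nx \<Rightarrow>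
     nat \<Rightarrow> real \<Rightarrow>
     (real ^ 'nx) \<times> (real ^ 'ny) \<times> ((real ^ 'nx) \<times> (real ^ 'ny)) set \<times> real \<Rightarrow> bool" where
  "SDM c q \<rho> K V\<^sub>0 x\<^sub>0 y\<^sub>0 \<omega> z tmax \<tau> = (\<lambda>(x', y', V', \<phi>).
     \<exists>(n :: nat) (x :: nat \<Rightarrow> real ^ 'nx) (y :: nat \<Rightarrow> real ^ 'ny)
        (V :: nat \<Rightarrow> ((real ^ 'nx) \<times> (real ^ 'ny)) set)
        (xh :: nat \<Rightarrow> real ^ 'nx) (yh :: nat \<Rightarrow> real ^ 'ny)
        (\<omega>h :: nat \<Rightarrow> real ^ 'nx) (\<Gamma> :: nat \<Rightarrow> real).
       x 0 = x\<^sub>0 \<and> y 0 = y\<^sub>0 \<and> V 0 = V\<^sub>0 \<and> 1 \<le> n \<and> n \<le> tmax \<and>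
       (\<forall>t\<in>{1..n}.
          \<omega>h t = \<omega> + \<rho> *\<^sub>R (x (t - 1) - z) \<and>
          is_arg_min (\<lambda>(u, v). (c + \<omega>h t) \<bullet> u + q \<bullet> v)
            (\<lambda>v. v extreme_point_of (convex hull K)) (xh t, yh t) \<and>
          \<Gamma> t = - ((c + \<omega>h t) \<bullet> (xh t - x (t - 1)) + q \<bullet> (yh t - y (t - 1))) \<and>
          V t = V (t - 1) \<union> {(xh t, yh t)} \<and>
          is_arg_min (\<lambda>(u, v). aug_lagrangian c q \<rho> u v z \<omega>)
            (\<lambda>v. v \<in> convex hull (V t)) (x t, y t)) \<and>
       (\<forall>t\<in>{1..<n}. \<not> \<Gamma> t \<le> \<tau>) \<and> (\<Gamma> n \<le> \<tau> \<or> n = tmax) \<and>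
       x' = x n \<and> y' = y n \<and> V' = V n \<and>
       \<phi> = (c + \<omega>h 1) \<bullet> xh 1 + q \<bullet> yh 1)"

definition FWPH_stop ::
    "('s::finite \<Rightarrow> real) \<Rightarrow> real \<Rightarrow> (nat \<Rightarrow> 's \<Rightarrow> real ^ 'nx) \<Rightarrow> (nat \<Rightarrow> real ^ 'nx) \<Rightarrow> nat \<Rightarrow> bool" where
  "FWPH_stop p \<epsilon> x z k \<longleftrightarrow> sqrt (\<Sum>s\<in>UNIV. p s * (norm (x k s - z (k - 1)))\<^sup>2) < \<epsilon>"

text \<open>\<open>FWPH_run\<close> holds if the given sequences record a run of the algorithm. The inputs
  \<open>V\<^sub>s\<^sup>0, x\<^sub>s\<^sup>0, y\<^sub>s\<^sup>0, \<omega>\<^sub>s\<^sup>0\<close> are the entries with index 0; entries of index beyond the last iteration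
  performed are unconstrained.\<close>

definition FWPH_run ::
    "('s::finite \<Rightarrow> real) \<Rightarrow> real ^ 'nx \<Rightarrow> ('s \<Rightarrow> real ^ 'ny) \<Rightarrow>
     ('s \<Rightarrow> ((real ^ 'nx) \<times> (real ^ 'ny)) set) \<Rightarrow>
     real \<Rightarrow> real \<Rightarrow> real \<Rightarrow> enat \<Rightarrow> nat \<Rightarrow>
     (nat \<Rightarrow> 's \<Rightarrow> ((real ^ 'nx) \<times> (real ^ 'ny)) set) \<Rightarrow>
     (nat \<Rightarrow> 's \<Rightarrow> real ^ 'nx) \<Rightarrow> (nat \<Rightarrow> 's \<Rightarrow> real ^ 'ny) \<Rightarrow> (nat \<Rightarrow> 's \<Rightarrow> real ^ 'nx) \<Rightarrow>
     (nat \<Rightarrow> real ^ 'nx) \<Rightarrow> (nat \<Rightarrow> 's \<Rightarrow> real) \<Rightarrow> (nat \<Rightarrow> real) \<Rightarrow> bool" where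
  "FWPH_run p c q K \<rho> \<alpha> \<epsilon> kmax tmax V x y \<omega> z \<phi>s \<phi> \<longleftrightarrow>
     z 0 = (\<Sum>s\<in>UNIV. p s *\<^sub>R x 0 s) \<and>
     (\<forall>s. \<omega> 1 s = \<omega> 0 s + \<rho> *\<^sub>R (x 0 s - z 0)) \<and>
     (\<forall>k::nat. 1 \<le> k \<and> enat k \<le> kmax \<and> (\<forall>j\<in>{1..<k}. \<not> FWPH_stop p \<epsilon> x z j) \<longrightarrow>
        (\<forall>s. SDM c (q s) \<rho> (K s)
               (V (k - 1) s) ((1 - \<alpha>) *\<^sub>R z (k - 1) + \<alpha> *\<^sub>R x (k - 1) s) (y (k - 1) s)
               (\<omega> k s) (z (k - 1)) tmax 0
               (x k s, y k s, V k s, \<phi>s k s)) \<and>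
        \<phi> k = (\<Sum>s\<in>UNIV. p s * \<phi>s k s) \<and>
        z k = (\<Sum>s\<in>UNIV. p s *\<^sub>R x k s) \<and>
        (\<not> FWPH_stop p \<epsilon> x z k \<longrightarrow>
           (\<forall>s. \<omega> (k + 1) s = \<omega> k s + \<rho> *\<^sub>R (x k s - z k))))"

end

theory Submission
  imports Defs
begin

text \<open>The vertex sets \<open>V k s\<close> only grow, and only by extreme points of the polytope
  \<open>convex hull (K s)\<close>, so from some iteration \<open>M\<close> on they are constant. Write \<open>C s\<close> for the convex
  hull of the final set. From then on the algorithm is progressive hedging, that is, the alternating
  direction method of multipliers for the restricted problem: minimise the expected cost over
  \<open>(x s, y s) \<in> C s\<close> subject to all \<open>x s\<close> being equal. The extreme point that defines \<open>\<phi>s\<close> is put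
  into \<open>V\<close> at once, so \<open>\<phi>\<close> is at the same time a value of the Lagrangian dual function of the original
  problem, hence at most \<open>\<zeta>\<close> (weak duality), and a value of the dual function of the restricted problem.

  The restricted problem is feasible. Otherwise a hyperplane strictly separates the attainable
  deviations from consensus from 0, so the multipliers drift linearly in a fixed direction. On the
  other hand, an upper bound on the dual values bounds the increments of the squared norm of the
  multipliers, which therefore have norm of order \<open>sqrt k\<close> only: a contradiction
  (\<open>energy_bound_contradicts_drift\<close>).

  Being a feasible linear program over a polytope, the restricted problem has an exact Lagrange
  multiplier \<open>P\<close> (\<open>linear_program_multiplier\<close>). The usual energy, the squared distance of multiplier
  and centre to \<open>P\<close> and to a primal solution, then decreases by at least the squared increments
  (\<open>Fejer_monotone_increments\<close>). The increments tend to 0, and the dual values are bounded below by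
  the restricted optimum up to a null sequence (\<open>alternating_direction_dual_values\<close>). The restricted
  optimum is at least \<open>\<zeta>\<close>, because \<open>C s \<subseteq> convex hull (K s)\<close>. So \<open>\<phi>\<close> is squeezed between
  \<open>\<zeta>\<close> plus a null sequence and \<open>\<zeta>\<close>.\<close>

section \<open>Polytopes from mixed-integer sets\<close>

text \<open>Boundedness leaves finitely many values for the integral functionals. Fixing these values cuts the
  set into finitely many bounded polyhedra, and the vertices of all of them together span the hull.\<close>

lemma polytope_convex_hull_mixed_integer:
  fixes P :: "'a::euclidean_space set"
  assumes "polyhedron P" "finite I"
    and bounded: "bounded (P \<inter> {v. \<forall>i\<in>I. i \<bullet> v \<in> \<int>})"
  shows "polytope (convex hull (P \<inter> {v. \<forall>i\<in>I. i \<bullet> v \<in> \<int>}))"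
proof -
  let ?S = "P \<inter> {v. \<forall>i\<in>I. i \<bullet> v \<in> \<int>}"
  obtain B where B: "\<And>v. v \<in> ?S \<Longrightarrow> norm v \<le> B"
    using bounded by (auto simp: bounded_iff)
  define Z where "Z i = {n::real. n \<in> \<int> \<and> - (norm i * B) \<le> n \<and> n \<le> norm i * B}" for i :: 'a
  have finite_Z: "finite (PiE I Z)"
    unfolding Z_def using \<open>finite I\<close> by (intro finite_PiE finite_int_segment)
  define slice where "slice g = P \<inter> \<Inter>((\<lambda>i. {v. i \<bullet> v = g i}) ` I)" for g :: "'a \<Rightarrow> real"
  have slice_subset: "slice g \<subseteq> ?S" if "g \<in> PiE I Z" for g
    using that by (force simp: slice_def Z_def PiE_iff)
  have "polytope (slice g)" if "g \<in> PiE I Z" for g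
  proof -
    have "polyhedron (slice g)"
      unfolding slice_def using assms(1,2)
      by (intro polyhedron_Int polyhedron_Inter) (auto simp: polyhedron_hyperplane)
    moreover have "bounded (slice g)"
      using bounded_subset[OF bounded slice_subset[OF that]] .
    ultimately show ?thesis
      by (simp add: polytope_eq_bounded_polyhedron)
  qed
  then obtain F where F: "\<And>g. g \<in> PiE I Z \<Longrightarrow> finite (F g) \<and> slice g = convex hull (F g)"
    unfolding polytope_def by metis
  have cover: "?S \<subseteq> (\<Union>g\<in>PiE I Z. slice g)"
  proof
    fix v assume v: "v \<in> ?S"
    have "\<bar>i \<bullet> v\<bar> \<le> norm i * B" for i
      using Cauchy_Schwarz_ineq2[of i v] B[OF v] by (meson mult_left_mono norm_ge_zero order_trans)
    then have "restrict (\<lambda>i. i \<bullet> v) I \<in> PiE I Z"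
      using v by (auto simp: Z_def abs_le_iff minus_le_iff)
    moreover have "v \<in> slice (restrict (\<lambda>i. i \<bullet> v) I)"
      using v by (auto simp: slice_def)
    ultimately show "v \<in> (\<Union>g\<in>PiE I Z. slice g)" by blast
  qed
  let ?U = "\<Union>g\<in>PiE I Z. F g"
  have "?S \<subseteq> convex hull ?U"
  proof
    fix v assume "v \<in> ?S"
    then obtain g where g: "g \<in> PiE I Z" "v \<in> convex hull (F g)"
      using cover F by blast
    then show "v \<in> convex hull ?U"
      using hull_mono[of "F g" ?U convex] by blast
  qed
  moreover have "?U \<subseteq> convex hull ?S"
  proof
    fix v assume "v \<in> ?U"
    then obtain g where g: "g \<in> PiE I Z" "v \<in> F g" by blast
    then have "v \<in> slice g"
      using F[OF g(1)] by (simp add: hull_inc)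
    then show "v \<in> convex hull ?S"
      by (intro hull_inc subsetD[OF slice_subset[OF g(1)]])
  qed
  ultimately have "convex hull ?S = convex hull ?U"
    by (intro subset_antisym hull_minimal convex_convex_hull)
  then show ?thesis
    using finite_Z F by (simp add: polytope_convex_hull)
qed

lemma scenario_set_mixed_integer:
  fixes W :: "real ^ 'ny ^ 'm" and T :: "real ^ 'nx ^ 'm"
  assumes "mixed_integer_linear X" "mixed_integer_linear Y"
  obtains P I where "polyhedron P" "finite I"
    "scenario_set W T h X Y = P \<inter> {v. \<forall>i\<in>I. i \<bullet> v \<in> \<int>}"
proof -
  obtain CX IX where X: "finite CX"
    "X = {x. (\<forall>(a, b) \<in> CX. a \<bullet> x \<le> b) \<and> (\<forall>i \<in> IX. x $ i \<in> \<int>)}"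
    using assms(1) by (auto simp: mixed_integer_linear_def)
  obtain CY IY where Y: "finite CY"
    "Y = {x. (\<forall>(a, b) \<in> CY. a \<bullet> x \<le> b) \<and> (\<forall>i \<in> IY. x $ i \<in> \<int>)}"
    using assms(2) by (auto simp: mixed_integer_linear_def)
  define E :: "((real ^ 'nx) \<times> (real ^ 'ny)) set set"
    where "E = range (\<lambda>j. {v. (T $ j, W $ j) \<bullet> v = h $ j})
      \<union> (\<lambda>(a, b). {v. (a, 0) \<bullet> v \<le> b}) ` CX \<union> (\<lambda>(a, b). {v. (0, a) \<bullet> v \<le> b}) ` CY"
  define I :: "((real ^ 'nx) \<times> (real ^ 'ny)) set"
    where "I = (\<lambda>i. (axis i 1, 0)) ` IX \<union> (\<lambda>i. (0, axis i 1)) ` IY"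
  have "finite E"
    using X(1) Y(1) by (auto simp: E_def)
  then have "polyhedron (\<Inter>E)"
    by (intro polyhedron_Inter) (auto simp: E_def polyhedron_hyperplane polyhedron_halfspace_le)
  moreover have "finite I"
    by (auto simp: I_def)
  moreover have "scenario_set W T h X Y = \<Inter>E \<inter> {v. \<forall>i\<in>I. i \<bullet> v \<in> \<int>}"
  proof (rule set_eqI)
    fix v :: "(real ^ 'nx) \<times> (real ^ 'ny)"
    obtain x y where v: "v = (x, y)" by force
    have "W *v y = h - T *v x \<longleftrightarrow> (\<forall>j. (T $ j, W $ j) \<bullet> v = h $ j)"
      by (auto simp: v vec_eq_iff matrix_vector_mul_component algebra_simps)
    then show "v \<in> scenario_set W T h X Y \<longleftrightarrow> v \<in> \<Inter>E \<inter> {v. \<forall>i\<in>I. i \<bullet> v \<in> \<int>}"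
      by (auto simp: v scenario_set_def X(2) Y(2) E_def I_def ball_Un inner_axis')
  qed
  ultimately show thesis by (rule that)
qed

lemma polytope_vec:
  fixes C :: "'s::finite \<Rightarrow> 'a::euclidean_space set"
  assumes "\<And>s. polytope (C s)"
  shows "polytope {w :: 'a ^ 's. \<forall>s. w $ s \<in> C s}"
proof -
  have "polyhedron {w :: 'a ^ 's. w $ s \<in> C s}" for s
  proof -
    have "polyhedron (C s)"
      using assms by (rule polytope_imp_polyhedron)
    then obtain F where F: "finite F" "C s = \<Inter>F" "\<forall>H\<in>F. \<exists>a b. a \<noteq> 0 \<and> H = {x. a \<bullet> x \<le> b}"
      unfolding polyhedron_def by blast
    have "polyhedron {w :: 'a ^ 's. w $ s \<in> H}" if H: "H \<in> F" for H
    proof -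
      obtain a b where "H = {x. a \<bullet> x \<le> b}" using bspec[OF F(3) H] by auto
      then have "{w :: 'a ^ 's. w $ s \<in> H} = {w. axis s a \<bullet> w \<le> b}"
        by (simp add: inner_axis')
      then show ?thesis by (simp add: polyhedron_halfspace_le)
    qed
    moreover have "{w :: 'a ^ 's. w $ s \<in> C s} = \<Inter>((\<lambda>H. {w. w $ s \<in> H}) ` F)"
      using F(2) by auto
    ultimately show ?thesis using F(1) by auto
  qed
  then have "polyhedron (\<Inter>(range (\<lambda>s. {w :: 'a ^ 's. w $ s \<in> C s})))"
    by (intro polyhedron_Inter) auto
  moreover have "\<Inter>(range (\<lambda>s. {w. w $ s \<in> C s})) = {w :: 'a ^ 's. \<forall>s. w $ s \<in> C s}"
    by auto
  ultimately have "polyhedron {w :: 'a ^ 's. \<forall>s. w $ s \<in> C s}"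
    by simp
  moreover have "bounded {w :: 'a ^ 's. \<forall>s. w $ s \<in> C s}"
  proof -
    obtain B where B: "\<And>s v. v \<in> C s \<Longrightarrow> norm v \<le> B s"
      using polytope_imp_bounded[OF assms] unfolding bounded_iff by metis
    have "norm w \<le> (\<Sum>s\<in>UNIV. B s)" if "\<forall>s. w $ s \<in> C s" for w :: "'a ^ 's"
    proof -
      have "norm w \<le> (\<Sum>s\<in>UNIV. norm (w $ s))"
        unfolding norm_vec_def by (rule L2_set_le_sum) simp
      also have "\<dots> \<le> (\<Sum>s\<in>UNIV. B s)"
        using that B by (intro sum_mono) blast
      finally show ?thesis .
    qed
    then show ?thesis by (auto simp: bounded_iff)
  qed
  ultimately show ?thesis by (simp add: polytope_eq_bounded_polyhedron)
qed

section \<open>Exact multipliers for linear programs\<close>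

text \<open>A linear objective over a polytope leaves no duality gap and the dual optimum is attained: the cone
  generated by the pairs \<open>(A w, f w - f v)\<close> is polyhedral, hence closed, and optimality of \<open>v\<close> keeps
  \<open>(0, -1)\<close> out of it. A strictly separating functional has a positive last coordinate; dividing by
  it gives the multiplier. For a general compact convex set the cone need not be closed.\<close>

lemma linear_program_multiplier:
  fixes f :: "'h::euclidean_space \<Rightarrow> real" and A :: "'h \<Rightarrow> 'e::euclidean_space"
  assumes W: "polytope W" and lin: "linear f" "linear A"
    and v: "v \<in> W" "A v = 0"
    and opt: "\<And>w. w \<in> W \<Longrightarrow> A w = 0 \<Longrightarrow> f v \<le> f w"
  obtains P where "\<And>w. w \<in> W \<Longrightarrow> f v \<le> f w + P \<bullet> A w"
proof -
  let ?L = "\<lambda>w. (A w, f w)"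
  let ?G = "(+) (0, - f v) ` ?L ` W"
  have "linear ?L"
    using lin by (auto simp: linear_iff)
  then have G: "polytope ?G"
    using W by (simp only: polytope_translation_eq polytope_linear_image)
  let ?K = "convex_cone hull ?G"
  have K: "convex ?K" "closed ?K"
    using polyhedron_convex_cone_hull_polytope[OF G] polyhedron_imp_closed polyhedron_imp_convex by blast+
  have "(0, -1) \<notin> ?K"
  proof
    assume "(0, -1) \<in> ?K"
    then obtain g t where g: "g \<in> convex hull ?G" "0 \<le> t" "(0, -1) = t *\<^sub>R g"
      by (auto simp: convex_cone_hull_convex_hull zero_prod_def)
    have "convex ?G" using G by (rule polytope_imp_convex)
    then have "g \<in> ?G" using g(1) hull_same[of convex ?G] by metis
    then obtain w where w: "w \<in> W" "g = (A w, f w - f v)" by auto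
    have *: "t *\<^sub>R A w = 0" "t * (f w - f v) = -1"
      using g(3) w(2) by auto
    then have "t \<noteq> 0" by auto
    then have "A w = 0" using *(1) by simp
    then have "f v \<le> f w" using opt w by blast
    then have "0 \<le> t * (f w - f v)" using g(2) by simp
    then show False using * by simp
  qed
  from separating_hyperplane_closed_point[OF K this]
  obtain a b where ab: "a \<bullet> (0, -1) < b" "\<And>x. x \<in> ?K \<Longrightarrow> a \<bullet> x > b" by blast
  obtain a1 \<tau> where a: "a = (a1, \<tau>)" by force
  have "b < 0"
    using ab(2)[OF convex_cone_hull_contains_0] by simp
  have nonneg: "0 \<le> a \<bullet> x" if "x \<in> ?K" for x
  proof (rule ccontr)
    assume neg: "\<not> 0 \<le> a \<bullet> x"
    have "(b / (a \<bullet> x)) *\<^sub>R x \<in> ?K"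
      using that neg \<open>b < 0\<close> by (intro convex_cone_hull_mul) (auto simp: divide_nonpos_neg)
    from ab(2)[OF this] neg show False by simp
  qed
  have "\<tau> > 0"
    using ab(1) \<open>b < 0\<close> a by simp
  have "f v \<le> f w + (a1 /\<^sub>R \<tau>) \<bullet> A w" if "w \<in> W" for w
  proof -
    have "(A w, f w - f v) \<in> ?K"
      using that by (intro hull_inc) force
    from nonneg[OF this] have "0 \<le> a1 \<bullet> A w + \<tau> * (f w - f v)"
      by (simp add: a)
    then have "0 \<le> (a1 \<bullet> A w + \<tau> * (f w - f v)) / \<tau>" using \<open>\<tau> > 0\<close> by simp
    then show ?thesis using \<open>\<tau> > 0\<close> by (simp add: field_simps)
  qed
  then show thesis by (rule that)
qed

section \<open>Two energy arguments\<close>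

text \<open>The first hypothesis bounds the increments of \<open>(norm (U k))\<^sup>2\<close>, so \<open>U k\<close> grows at most like
  \<open>sqrt k\<close>, while the second forces linear growth along \<open>a\<close>. Instead of comparing the two rates, the
  proof applies Young's inequality to \<open>a \<bullet> U k\<close>.\<close>

lemma energy_bound_contradicts_drift:
  fixes U :: "nat \<Rightarrow> 'e::real_inner"
  assumes energy: "\<And>k. U (Suc k) \<bullet> (U (Suc k) - U k) \<le> R"
    and drift: "\<And>k. b \<le> a \<bullet> (U (Suc k) - U k)" and "b > 0"
  shows False
proof -
  have upper: "(norm (U k))\<^sup>2 \<le> (norm (U 0))\<^sup>2 + 2 * R * real k" for k
  proof (induction k)
    case (Suc k)
    have "(norm (U (Suc k)))\<^sup>2 + (norm (U (Suc k) - U k))\<^sup>2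
        = (norm (U k))\<^sup>2 + 2 * (U (Suc k) \<bullet> (U (Suc k) - U k))"
      by (simp add: power2_norm_eq_inner algebra_simps inner_commute)
    then have "(norm (U (Suc k)))\<^sup>2 \<le> (norm (U k))\<^sup>2 + 2 * R"
      using energy[of k] zero_le_power2[of "norm (U (Suc k) - U k)"] by linarith
    then show ?case using Suc by (simp add: algebra_simps)
  qed simp
  have lower: "a \<bullet> U 0 + b * real k \<le> a \<bullet> U k" for k
  proof (induction k)
    case (Suc k)
    then show ?case using drift[of k] by (simp add: algebra_simps)
  qed simp
  \<comment> \<open>The weight \<open>t\<close> in Young's inequality makes the quadratic bound grow at half the slope of the drift.\<close>
  define t where "t = 2 * (\<bar>R\<bar> + 1) / b"
  have "t > 0" using \<open>b > 0\<close> by (simp add: t_def add_nonneg_pos)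
  have slope: "R / t \<le> b / 2"
  proof -
    have "R / t \<le> (\<bar>R\<bar> + 1) / t"
      using \<open>t > 0\<close> by (intro divide_right_mono) auto
    also have "\<dots> = b / 2"
    proof -
      have "x / (2 * x / b) = b / 2" if "x > 0" for x :: real
        using that \<open>b > 0\<close> by (simp add: field_simps)
      from this[of "\<bar>R\<bar> + 1"] show ?thesis unfolding t_def by simp
    qed
    finally show ?thesis .
  qed
  have young: "a \<bullet> u \<le> t * (norm a)\<^sup>2 / 2 + (norm u)\<^sup>2 / (2 * t)" for u
  proof -
    have "0 \<le> (norm (t *\<^sub>R a - u))\<^sup>2" by simp
    also have "\<dots> = t\<^sup>2 * (norm a)\<^sup>2 + (norm u)\<^sup>2 - 2 * t * (a \<bullet> u)"
      unfolding power2_norm_eq_inner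
      by (simp add: algebra_simps inner_commute power2_eq_square)
    finally show ?thesis
      using \<open>t > 0\<close> by (simp add: field_simps power2_eq_square)
  qed
  define M where "M = t * (norm a)\<^sup>2 / 2 + (norm (U 0))\<^sup>2 / (2 * t) - a \<bullet> U 0"
  have "b / 2 * real k \<le> M" for k
  proof -
    have "a \<bullet> U 0 + b * real k \<le> t * (norm a)\<^sup>2 / 2 + (norm (U k))\<^sup>2 / (2 * t)"
      using lower[of k] young[of "U k"] by linarith
    also have "(norm (U k))\<^sup>2 / (2 * t) \<le> ((norm (U 0))\<^sup>2 + 2 * R * real k) / (2 * t)"
      using upper[of k] \<open>t > 0\<close> by (intro divide_right_mono) auto
    also have "\<dots> = (norm (U 0))\<^sup>2 / (2 * t) + R / t * real k"
      using \<open>t > 0\<close> by (simp add: field_simps)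
    also have "R / t * real k \<le> b / 2 * real k"
      using slope by (intro mult_right_mono) auto
    finally show ?thesis by (simp add: M_def)
  qed
  moreover obtain k where "M / (b / 2) < real k" using reals_Archimedean2 by blast
  then have "M < b / 2 * real k"
    using \<open>b > 0\<close> by (simp add: field_simps)
  ultimately show False by (meson not_less)
qed

text \<open>The hypothesis is what the optimality conditions of an alternating direction step leave after
  comparison with a saddle point \<open>(x, P)\<close>. By the three-point identity it says that the energy
  \<open>\<Lambda>\<close> loses at least the squared increments in each step.\<close>

lemma Fejer_monotone_increments:
  fixes U :: "nat \<Rightarrow> 'e::real_inner" and Z :: "nat \<Rightarrow> 'a::real_inner"
  assumes rho: "\<rho> > 0"
    and step: "\<And>k. (U (Suc k) - P) \<bullet> (U (Suc k) - U k) / \<rho>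
                  + \<rho> * ((Z (Suc k) - Z k) \<bullet> (Z (Suc k) - x)) \<le> 0"
  shows "(\<lambda>k. U (Suc k) - U k) \<longlonglongrightarrow> 0" "(\<lambda>k. Z (Suc k) - Z k) \<longlonglongrightarrow> 0" "Bseq U"
proof -
  define \<Lambda> where "\<Lambda> k = (norm (U k - P))\<^sup>2 / \<rho> + \<rho> * (norm (Z k - x))\<^sup>2" for k
  have descent: "\<Lambda> (Suc k) + ((norm (U (Suc k) - U k))\<^sup>2 / \<rho> + \<rho> * (norm (Z (Suc k) - Z k))\<^sup>2) \<le> \<Lambda> k" for k
  proof -
    have three_point: "(norm (a - c))\<^sup>2 + (norm (a - b))\<^sup>2 = (norm (b - c))\<^sup>2 + 2 * ((a - c) \<bullet> (a - b))"
      for a b c :: "'x::real_inner"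
      by (simp add: power2_norm_eq_inner algebra_simps inner_commute)
    have "\<Lambda> (Suc k) + ((norm (U (Suc k) - U k))\<^sup>2 / \<rho> + \<rho> * (norm (Z (Suc k) - Z k))\<^sup>2)
       = ((norm (U (Suc k) - P))\<^sup>2 + (norm (U (Suc k) - U k))\<^sup>2) / \<rho>
         + \<rho> * ((norm (Z (Suc k) - x))\<^sup>2 + (norm (Z (Suc k) - Z k))\<^sup>2)"
      by (simp add: \<Lambda>_def add_divide_distrib algebra_simps)
    also have "\<dots> = \<Lambda> k + 2 * ((U (Suc k) - P) \<bullet> (U (Suc k) - U k) / \<rho>
                  + \<rho> * ((Z (Suc k) - Z k) \<bullet> (Z (Suc k) - x)))"
      unfolding three_point \<Lambda>_def inner_commute[of "Z (Suc k) - x"]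
      by (simp add: add_divide_distrib distrib_left)
    finally have eq: "\<Lambda> (Suc k) + ((norm (U (Suc k) - U k))\<^sup>2 / \<rho> + \<rho> * (norm (Z (Suc k) - Z k))\<^sup>2)
       = \<Lambda> k + 2 * ((U (Suc k) - P) \<bullet> (U (Suc k) - U k) / \<rho>
                  + \<rho> * ((Z (Suc k) - Z k) \<bullet> (Z (Suc k) - x)))" .
    show ?thesis unfolding eq using step[of k] by simp
  qed
  have nonneg: "0 \<le> \<Lambda> k" for k using rho by (simp add: \<Lambda>_def)
  have parts: "0 \<le> (norm (U (Suc k) - U k))\<^sup>2 / \<rho>" "0 \<le> \<rho> * (norm (Z (Suc k) - Z k))\<^sup>2" for k
    using rho by auto
  have dec: "decseq \<Lambda>"
    using descent parts by (intro decseq_SucI) (smt (verit))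
  then obtain L where "\<Lambda> \<longlonglongrightarrow> L"
    using decseq_convergent[of \<Lambda> 0] nonneg by blast
  then have "(\<lambda>k. \<Lambda> k - \<Lambda> (Suc k)) \<longlonglongrightarrow> L - L"
    by (intro tendsto_diff LIMSEQ_Suc)
  then have gap: "(\<lambda>k. \<Lambda> k - \<Lambda> (Suc k)) \<longlonglongrightarrow> 0" by simp
  have squares: "(\<lambda>k. norm (D k)) \<longlonglongrightarrow> 0"
    if c: "c > 0" and D: "\<And>k. c * (norm (D k))\<^sup>2 \<le> \<Lambda> k - \<Lambda> (Suc k)" for c and D :: "nat \<Rightarrow> 'x::real_inner"
  proof -
    have "(\<lambda>k. (norm (D k))\<^sup>2) \<longlonglongrightarrow> 0"
    proof (rule tendsto_sandwich[where f = "\<lambda>_. 0"])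
      show "(\<lambda>k. (\<Lambda> k - \<Lambda> (Suc k)) / c) \<longlonglongrightarrow> 0"
        using tendsto_divide[OF gap tendsto_const[of c]] c by simp
      show "eventually (\<lambda>k. (norm (D k))\<^sup>2 \<le> (\<Lambda> k - \<Lambda> (Suc k)) / c) sequentially"
        using D c by (simp add: field_simps)
    qed auto
    from tendsto_real_sqrt[OF this] show ?thesis by simp
  qed
  have "1 / \<rho> * (norm (U (Suc k) - U k))\<^sup>2 \<le> \<Lambda> k - \<Lambda> (Suc k)" for k
    using descent[of k] parts[of k] by simp
  from squares[OF _ this] rho show "(\<lambda>k. U (Suc k) - U k) \<longlonglongrightarrow> 0"
    by (simp add: tendsto_norm_zero_iff)
  have "\<rho> * (norm (Z (Suc k) - Z k))\<^sup>2 \<le> \<Lambda> k - \<Lambda> (Suc k)" for k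
    using descent[of k] parts[of k] by simp
  from squares[OF rho this] show "(\<lambda>k. Z (Suc k) - Z k) \<longlonglongrightarrow> 0"
    by (simp add: tendsto_norm_zero_iff)
  have "norm (U k) \<le> sqrt (\<rho> * \<Lambda> 0) + norm P" for k
  proof -
    have "(norm (U k - P))\<^sup>2 / \<rho> \<le> \<Lambda> k" using rho by (simp add: \<Lambda>_def)
    also have "\<dots> \<le> \<Lambda> 0" using dec by (simp add: decseq_def)
    finally have "(norm (U k - P))\<^sup>2 \<le> \<rho> * \<Lambda> 0" using rho by (simp add: field_simps)
    then have "norm (U k - P) \<le> sqrt (\<rho> * \<Lambda> 0)" by (rule real_le_rsqrt)
    then show ?thesis using norm_triangle_sub[of "U k" P] by linarith
  qed
  then show "Bseq U" by (rule BseqI')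
qed

section \<open>Dual values of the alternating direction method\<close>

lemma bounded_linear_image_bound:
  fixes A :: "'h::euclidean_space \<Rightarrow> 'e::real_normed_vector"
  assumes "bounded W" "linear A"
  obtains B where "B \<ge> 0" "\<And>w. w \<in> W \<Longrightarrow> norm (A w) \<le> B"
proof -
  have "bounded (A ` W)"
    using assms by (simp add: bounded_linear_image linear_conv_bounded_linear)
  then obtain B where "\<And>w. w \<in> W \<Longrightarrow> norm (A w) \<le> B" by (auto simp: bounded_iff)
  then show thesis by (intro that[of "max B 0"]) (auto intro: max.coboundedI1)
qed

text \<open>The method is run on: minimise \<open>f\<close> over \<open>W\<close> subject to \<open>A w = 0\<close>, with multipliers \<open>U\<close> and a
  centre \<open>Z\<close>. The variational inequality says that \<open>w k\<close> minimises the Lagrangian at the updated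
  multiplier up to a term in the change of the centre. The number \<open>\<theta> k\<close> is the Lagrangian at another
  point \<open>g k\<close> of \<open>W\<close> and at a multiplier perturbed by a multiple of the residual \<open>A (w k)\<close>; it is a
  dual value if \<open>g k\<close> minimises. Testing the variational inequality at \<open>g k\<close> bounds \<open>\<theta> k\<close> from below
  by the Lagrangian at \<open>w k\<close>, with an error controlled by the increments of \<open>U\<close> and \<open>Z\<close>. The upper
  bound \<open>B\<close> on \<open>\<theta>\<close> forces the constraint \<open>A w = 0\<close> to be solvable in \<open>W\<close>. The \<open>v\<close> obtained in
  the proof minimises \<open>f\<close> under that constraint.\<close>

lemma alternating_direction_dual_values:
  fixes f :: "'h::euclidean_space \<Rightarrow> real" and A :: "'h \<Rightarrow> 'e::euclidean_space"
    and m :: "'h \<Rightarrow> 'a::euclidean_space"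
  assumes W: "polytope W" and lin: "linear f" "linear A" "linear m" and rho: "\<rho> > 0"
    and w: "\<And>k. w k \<in> W" and g: "\<And>k. g k \<in> W"
    and multiplier: "\<And>k. U (Suc k) = U k + \<rho> *\<^sub>R A (w k)"
    and centre: "\<And>k. Z (Suc k) = m (w k)"
    and variational: "\<And>k v. v \<in> W \<Longrightarrow>
          f (w k) + U (Suc k) \<bullet> A (w k) + \<rho> * ((Z (Suc k) - Z k) \<bullet> m (w k))
          \<le> f v + U (Suc k) \<bullet> A v + \<rho> * ((Z (Suc k) - Z k) \<bullet> m v)"
    and dual: "\<And>k. \<theta> k = f (g k) + (U (Suc k) + (\<alpha> * \<rho>) *\<^sub>R A (w k)) \<bullet> A (g k)"
    and bound: "\<And>k. \<theta> k \<le> B"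
  obtains v e where "v \<in> W" "A v = 0" "e \<longlonglongrightarrow> 0" "\<And>k. f v + e k \<le> \<theta> k"
proof -
  have increment: "U (Suc k) - U k = \<rho> *\<^sub>R A (w k)" for k by (simp add: multiplier)
  obtain BA where BA: "BA \<ge> 0" "\<And>w. w \<in> W \<Longrightarrow> norm (A w) \<le> BA"
    using bounded_linear_image_bound[OF polytope_imp_bounded[OF W] lin(2)] by blast
  obtain Bm where Bm: "Bm \<ge> 0" "\<And>w. w \<in> W \<Longrightarrow> norm (m w) \<le> Bm"
    using bounded_linear_image_bound[OF polytope_imp_bounded[OF W] lin(3)] by blast
  obtain Bf where Bf: "Bf \<ge> 0" "\<And>w. w \<in> W \<Longrightarrow> norm (f w) \<le> Bf"
    using bounded_linear_image_bound[OF polytope_imp_bounded[OF W] lin(1)] by blast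
  have value_bound: "f (w k) + U (Suc k) \<bullet> A (w k) + \<rho> * ((Z (Suc k) - Z k) \<bullet> (m (w k) - m (g k)))
      + \<alpha> * ((U (Suc k) - U k) \<bullet> A (g k)) \<le> \<theta> k" for k
    using variational[OF g[of k], of k] by (simp add: dual increment algebra_simps)
  have "0 \<in> A ` W"
  proof (rule ccontr)
    assume "0 \<notin> A ` W"
    with polytope_linear_image[OF lin(2) W]
    have "\<exists>a b. a \<noteq> 0 \<and> 0 < b \<and> (\<forall>x\<in>A ` W. b < a \<bullet> x)"
      by (intro separating_hyperplane_closed_0 polytope_imp_convex polytope_imp_closed)
    then obtain a b where "b > 0" and ab: "\<And>w. w \<in> W \<Longrightarrow> b < a \<bullet> A w"
      by auto
    \<comment> \<open>Only \<open>Z (Suc k)\<close> is known to lie in the image of \<open>m\<close>, so the uniform bounds start at index 1.\<close>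
    have Z_diff: "norm (Z (Suc (Suc k)) - Z (Suc k)) \<le> 2 * Bm" for k
      using norm_triangle_ineq4[of "m (w (Suc k))" "m (w k)"] Bm(2)[OF w[of k]] Bm(2)[OF w[of "Suc k"]]
      by (simp add: centre)
    define R where "R = \<rho> * (B + Bf + \<rho> * (2 * Bm * (2 * Bm)) + \<bar>\<alpha>\<bar> * (\<rho> * BA * BA))"
    have "U (Suc (Suc k)) \<bullet> (U (Suc (Suc k)) - U (Suc k)) \<le> R" for k
    proof -
      let ?k = "Suc k"
      have "\<bar>(Z (Suc ?k) - Z ?k) \<bullet> (m (w ?k) - m (g ?k))\<bar> \<le> 2 * Bm * (2 * Bm)"
      proof -
        have "norm (m (w ?k) - m (g ?k)) \<le> 2 * Bm"
          using norm_triangle_ineq4[of "m (w ?k)" "m (g ?k)"] Bm(2)[OF w[of ?k]] Bm(2)[OF g[of ?k]] by simp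
        then have "norm (Z (Suc ?k) - Z ?k) * norm (m (w ?k) - m (g ?k)) \<le> 2 * Bm * (2 * Bm)"
          using Z_diff[of k] Bm(1) by (intro mult_mono) auto
        then show ?thesis by (rule order_trans[OF Cauchy_Schwarz_ineq2])
      qed
      then have "- (\<rho> * (2 * Bm * (2 * Bm))) \<le> \<rho> * ((Z (Suc ?k) - Z ?k) \<bullet> (m (w ?k) - m (g ?k)))"
        using mult_left_mono[of "- (2 * Bm * (2 * Bm))" "(Z (Suc ?k) - Z ?k) \<bullet> (m (w ?k) - m (g ?k))" \<rho>] rho
        by auto
      moreover have "- (\<bar>\<alpha>\<bar> * (\<rho> * BA * BA)) \<le> \<alpha> * ((U (Suc ?k) - U ?k) \<bullet> A (g ?k))"
      proof -
        have "norm (\<rho> *\<^sub>R A (w ?k)) * norm (A (g ?k)) \<le> \<rho> * BA * BA"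
          using BA(2)[OF w[of ?k]] BA(2)[OF g[of ?k]] BA(1) rho by (intro mult_mono) auto
        then have "\<bar>(U (Suc ?k) - U ?k) \<bullet> A (g ?k)\<bar> \<le> \<rho> * BA * BA"
          unfolding increment by (rule order_trans[OF Cauchy_Schwarz_ineq2])
        then have "\<bar>\<alpha> * ((U (Suc ?k) - U ?k) \<bullet> A (g ?k))\<bar> \<le> \<bar>\<alpha>\<bar> * (\<rho> * BA * BA)"
          unfolding abs_mult by (intro mult_left_mono) auto
        then show ?thesis by linarith
      qed
      moreover have "- Bf \<le> f (w ?k)" using Bf(2)[OF w[of ?k]] by auto
      ultimately have "U (Suc ?k) \<bullet> A (w ?k) \<le> R / \<rho>"
        using value_bound[of ?k] bound[of ?k] rho by (simp add: R_def)
      then show ?thesis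
        unfolding increment using rho by (simp add: field_simps)
    qed
    moreover have "\<rho> * b \<le> a \<bullet> (U (Suc (Suc k)) - U (Suc k))" for k
      unfolding increment using ab[OF w[of "Suc k"]] rho by simp
    ultimately show False
      using energy_bound_contradicts_drift[of "\<lambda>k. U (Suc k)" R "\<rho> * b" a] \<open>b > 0\<close> rho by simp
  qed
  then obtain v0 where v0: "v0 \<in> W" "A v0 = 0" by auto
  have "compact (W \<inter> A -` {0})"
    using W lin(2) by (intro compact_Int_closed polytope_imp_compact closed_vimage)
      (auto simp: linear_continuous_on linear_conv_bounded_linear)
  moreover have "continuous_on (W \<inter> A -` {0}) f"
    using lin(1) by (simp add: linear_continuous_on linear_conv_bounded_linear)
  ultimately obtain v where v: "v \<in> W" "A v = 0" "\<And>u. u \<in> W \<Longrightarrow> A u = 0 \<Longrightarrow> f v \<le> f u"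
    using continuous_attains_inf[of "W \<inter> A -` {0}" f] v0 by auto
  obtain P where P: "\<And>u. u \<in> W \<Longrightarrow> f v \<le> f u + P \<bullet> A u"
    using linear_program_multiplier[OF W lin(1,2) v(1,2)] v(3) by blast
  \<comment> \<open>Lower bound from the multiplier against upper bound from testing the variational inequality at \<open>v\<close>.\<close>
  have "(U (Suc k) - P) \<bullet> (U (Suc k) - U k) / \<rho> + \<rho> * ((Z (Suc k) - Z k) \<bullet> (Z (Suc k) - m v)) \<le> 0" for k
  proof -
    have "(U (Suc k) - P) \<bullet> (U (Suc k) - U k) / \<rho> = (U (Suc k) - P) \<bullet> A (w k)"
      using rho by (simp add: increment)
    then show ?thesis
      using variational[OF v(1), of k] P[OF w[of k]]
      by (simp add: centre v(2) algebra_simps)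
  qed
  note fejer = Fejer_monotone_increments[where U = U and Z = Z and P = P and x = "m v", OF rho this]
  define e where "e k = (U (Suc k) - P) \<bullet> (U (Suc k) - U k) / \<rho>
      + \<rho> * ((Z (Suc k) - Z k) \<bullet> (m (w k) - m (g k))) + \<alpha> * ((U (Suc k) - U k) \<bullet> A (g k))" for k
  have "f v + e k \<le> \<theta> k" for k
    using value_bound[of k] P[OF w[of k]] rho
    by (simp add: e_def increment inner_diff_left)
  moreover have "e \<longlonglongrightarrow> 0"
  proof -
    have null: "(\<lambda>k. D k \<bullet> E k) \<longlonglongrightarrow> 0" if "D \<longlonglongrightarrow> 0" "Bseq E"
      for D E :: "nat \<Rightarrow> 'x::real_inner"
      using bounded_bilinear.Zfun_prod_Bfun[OF bounded_bilinear_inner] that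
      by (simp add: tendsto_Zfun_iff)
    have "Bseq (\<lambda>k. U (Suc k) - P)"
      using fejer(3) by (simp add: Bseq_Suc_iff Bseq_add_iff[of _ "- P", simplified])
    from null[OF fejer(1) this] have "(\<lambda>k. (U (Suc k) - P) \<bullet> (U (Suc k) - U k)) \<longlonglongrightarrow> 0"
      by (simp add: inner_commute)
    moreover have "Bseq (\<lambda>k. A (g k))"
      using BA(2)[OF g] by (rule BseqI')
    note null[OF fejer(1) this]
    moreover have "Bseq (\<lambda>k. m (w k) - m (g k))"
    proof (rule BseqI')
      show "norm (m (w k) - m (g k)) \<le> Bm + Bm" for k
        using norm_triangle_ineq4[of "m (w k)" "m (g k)"] Bm(2)[OF w[of k]] Bm(2)[OF g[of k]] by simp
    qed
    note null[OF fejer(2) this]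
    ultimately have "e \<longlonglongrightarrow> 0 / \<rho> + \<rho> * 0 + \<alpha> * 0"
      unfolding e_def using rho by (intro tendsto_intros) auto
    then show ?thesis by simp
  qed
  ultimately show thesis
    using that[OF v(1,2), of e] by blast
qed

section \<open>The consensus problem in product space\<close>

text \<open>A choice of one point per scenario is a single vector \<open>w\<close> in \<open>('a \<times> 'b) ^ 's\<close>. The expected cost
  and the mean first-stage decision are linear in \<open>w\<close>, and consensus is the linear equation
  \<open>deviation p w = 0\<close>.\<close>

definition total_cost ::
    "('s::finite \<Rightarrow> real) \<Rightarrow> 'a::euclidean_space \<Rightarrow> ('s \<Rightarrow> 'b::euclidean_space) \<Rightarrow> ('a \<times> 'b) ^ 's \<Rightarrow> real" where
  "total_cost p c q w = (\<Sum>s\<in>UNIV. p s * (c \<bullet> fst (w $ s) + q s \<bullet> snd (w $ s)))"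

definition mean_first :: "('s::finite \<Rightarrow> real) \<Rightarrow> ('a::euclidean_space \<times> 'b::euclidean_space) ^ 's \<Rightarrow> 'a" where
  "mean_first p w = (\<Sum>s\<in>UNIV. p s *\<^sub>R fst (w $ s))"

text \<open>The square roots turn the standard inner product of two such vectors into the \<open>p\<close>-weighted sum of the
  scenario-wise inner products.\<close>

definition weighted :: "('s::finite \<Rightarrow> real) \<Rightarrow> ('s \<Rightarrow> 'a::euclidean_space) \<Rightarrow> 'a ^ 's" where
  "weighted p \<mu> = (\<chi> s. sqrt (p s) *\<^sub>R \<mu> s)"

definition deviation :: "('s::finite \<Rightarrow> real) \<Rightarrow> ('a::euclidean_space \<times> 'b::euclidean_space) ^ 's \<Rightarrow> 'a ^ 's" where
  "deviation p w = weighted p (\<lambda>s. fst (w $ s) - mean_first p w)"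

lemma linear_total_cost: "linear (total_cost p c q)"
  by (rule linearI)
    (simp_all add: total_cost_def inner_add_right algebra_simps sum.distrib sum_distrib_left)

lemma linear_mean_first: "linear (mean_first p)"
  by (rule linearI)
    (simp_all add: mean_first_def scaleR_add_right sum.distrib scaleR_sum_right mult.commute)

lemma linear_deviation: "linear (deviation p)"
  by (rule linearI)
    (simp_all add: deviation_def weighted_def vec_eq_iff linear_add[OF linear_mean_first]
      linear_scale[OF linear_mean_first] algebra_simps)

lemma weighted_add: "weighted p (\<lambda>s. \<mu> s + t *\<^sub>R \<nu> s) = weighted p \<mu> + t *\<^sub>R weighted p \<nu>"
  by (simp add: weighted_def vec_eq_iff algebra_simps)

text \<open>For multipliers of mean 0 the mean in the deviation drops out, so the Lagrangian of the consensus
  problem separates over the scenarios; the last summand adds the same vector \<open>d\<close> to every multiplier.\<close>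

lemma lagrangian_as_scenario_sum:
  assumes p: "\<And>s. p s \<ge> 0" and balanced: "(\<Sum>s\<in>UNIV. p s *\<^sub>R \<mu> s) = 0"
  shows "total_cost p c q w + weighted p \<mu> \<bullet> deviation p w + d \<bullet> mean_first p w
       = (\<Sum>s\<in>UNIV. p s * ((c + \<mu> s + d) \<bullet> fst (w $ s) + q s \<bullet> snd (w $ s)))"
proof -
  have "weighted p \<mu> \<bullet> deviation p w = (\<Sum>s\<in>UNIV. p s * (\<mu> s \<bullet> (fst (w $ s) - mean_first p w)))"
    using p by (simp add: weighted_def deviation_def inner_vec_def flip: mult.assoc)
  also have "\<dots> = (\<Sum>s\<in>UNIV. p s * (\<mu> s \<bullet> fst (w $ s))) - (\<Sum>s\<in>UNIV. p s *\<^sub>R \<mu> s) \<bullet> mean_first p w"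
    by (simp add: inner_diff_right right_diff_distrib sum_subtractf inner_sum_left)
  also have "\<dots> = (\<Sum>s\<in>UNIV. p s * (\<mu> s \<bullet> fst (w $ s)))"
    using balanced by simp
  finally show ?thesis
    by (simp add: total_cost_def mean_first_def inner_sum_right inner_add_left algebra_simps sum.distrib)
qed

section \<open>One call of the simplicial decomposition\<close>

text \<open>First-order optimality: along the segment to \<open>(u, v)\<close> the objective is a quadratic in the step
  length, whose linear coefficient must be nonnegative.\<close>

lemma augmented_lagrangian_minimizer_variational:
  fixes x z \<omega> c :: "real ^ 'nx" and y q :: "real ^ 'ny"
  assumes "convex C" and rho: "\<rho> > 0"
    and min: "is_arg_min (\<lambda>(u, v). aug_lagrangian c q \<rho> u v z \<omega>) (\<lambda>v. v \<in> C) (x, y)"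
    and uv: "(u, v) \<in> C"
  shows "(c + \<omega> + \<rho> *\<^sub>R (x - z)) \<bullet> x + q \<bullet> y \<le> (c + \<omega> + \<rho> *\<^sub>R (x - z)) \<bullet> u + q \<bullet> v"
proof -
  define g where "g = (c + \<omega> + \<rho> *\<^sub>R (x - z)) \<bullet> (u - x) + q \<bullet> (v - y)"
  define r where "r = \<rho> / 2 * (norm (u - x))\<^sup>2"
  have step: "0 \<le> g + t * r" if "0 < t" "t < 1" for t
  proof -
    have xy: "(x, y) \<in> C" using min by (simp add: is_arg_min_def)
    have "(1 - t) *\<^sub>R (x, y) + t *\<^sub>R (u, v) \<in> C"
      using convexD[OF \<open>convex C\<close> xy uv, of "1 - t" t] that by simp
    then have "(x + t *\<^sub>R (u - x), y + t *\<^sub>R (v - y)) \<in> C"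
      by (simp add: algebra_simps)
    then have "aug_lagrangian c q \<rho> x y z \<omega>
        \<le> aug_lagrangian c q \<rho> (x + t *\<^sub>R (u - x)) (y + t *\<^sub>R (v - y)) z \<omega>"
      using min by (auto simp: is_arg_min_linorder)
    also have "\<dots> = aug_lagrangian c q \<rho> x y z \<omega> + t * (g + t * r)"
      unfolding aug_lagrangian_def g_def r_def power2_norm_eq_inner
      by (simp add: algebra_simps inner_commute)
    finally have "0 \<le> t * (g + t * r)" by simp
    then show ?thesis using that by (simp add: zero_le_mult_iff)
  qed
  have "((\<lambda>t. g + t * r) \<longlongrightarrow> g + 0 * r) (at_right 0)"
    by (intro tendsto_intros)
  moreover have "eventually (\<lambda>t. 0 \<le> g + t * r) (at_right 0)"
    using eventually_at_right_real[of 0 1, OF zero_less_one] by eventually_elim (auto intro: step)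
  ultimately have "0 \<le> g"
    using tendsto_lowerbound[of _ g "at_right (0::real)"] by simp
  then show ?thesis by (simp add: g_def algebra_simps)
qed

text \<open>By the theorem of Minkowski (Krein-Milman in finite dimension), a linear functional attains its
  minimum over \<open>C\<close> at an extreme point.\<close>

lemma extreme_point_minimizer:
  fixes C :: "('a::euclidean_space \<times> 'b::euclidean_space) set"
  assumes "compact C" "convex C"
    and min: "is_arg_min (\<lambda>(u, v). a \<bullet> u + b \<bullet> v) (\<lambda>v. v extreme_point_of C) (u, v)"
    and "(x, y) \<in> C"
  shows "a \<bullet> u + b \<bullet> v \<le> a \<bullet> x + b \<bullet> y"
proof -
  have "convex hull {v. v extreme_point_of C} \<subseteq> {w. (a, b) \<bullet> (u, v) \<le> (a, b) \<bullet> w}"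
    using min by (intro hull_minimal convex_halfspace_ge)
      (auto simp: is_arg_min_linorder)
  then have "(a, b) \<bullet> (u, v) \<le> (a, b) \<bullet> (x, y)"
    using Krein_Milman_Minkowski[OF assms(1,2)] \<open>(x, y) \<in> C\<close> by auto
  then show ?thesis by simp
qed

text \<open>This is all that the convergence proof needs to know about a call: whatever the number of inner
  iterations, the returned point minimises over the hull of the returned vertex set, and \<open>\<phi>\<close> is
  attained at a point of that same set, namely the extreme point found in the first inner iteration.\<close>

lemma SDM_result:
  assumes "SDM c q \<rho> K V0 x0 y0 \<omega> z tmax \<tau> (x', y', V', \<phi>)"
  obtains u v where "V0 \<subseteq> V'" "V' \<subseteq> V0 \<union> {v. v extreme_point_of (convex hull K)}" "(u, v) \<in> V'"
    "is_arg_min (\<lambda>(u, v). (c + (\<omega> + \<rho> *\<^sub>R (x0 - z))) \<bullet> u + q \<bullet> v)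
       (\<lambda>v. v extreme_point_of (convex hull K)) (u, v)"
    "\<phi> = (c + (\<omega> + \<rho> *\<^sub>R (x0 - z))) \<bullet> u + q \<bullet> v"
    "is_arg_min (\<lambda>(u, v). aug_lagrangian c q \<rho> u v z \<omega>) (\<lambda>v. v \<in> convex hull V') (x', y')"
proof -
  obtain n x y V xh yh \<omega>h \<Gamma> where start: "x 0 = x0" "y 0 = y0" "V 0 = V0" and n: "1 \<le> n" "n \<le> tmax"
    and iter: "\<forall>t\<in>{1..n}.
          \<omega>h t = \<omega> + \<rho> *\<^sub>R (x (t - 1) - z) \<and>
          is_arg_min (\<lambda>(u, v). (c + \<omega>h t) \<bullet> u + q \<bullet> v)
            (\<lambda>v. v extreme_point_of (convex hull K)) (xh t, yh t) \<and>
          \<Gamma> t = - ((c + \<omega>h t) \<bullet> (xh t - x (t - 1)) + q \<bullet> (yh t - y (t - 1))) \<and>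
          V t = V (t - 1) \<union> {(xh t, yh t)} \<and>
          is_arg_min (\<lambda>(u, v). aug_lagrangian c q \<rho> u v z \<omega>)
            (\<lambda>v. v \<in> convex hull (V t)) (x t, y t)"
    and result: "x' = x n" "y' = y n" "V' = V n" "\<phi> = (c + \<omega>h 1) \<bullet> xh 1 + q \<bullet> yh 1"
    using assms unfolding SDM_def prod.case by (elim exE conjE) (rule that; assumption)
  note dir = iter[rule_format, THEN conjunct1]
    and ext = iter[rule_format, THEN conjunct2, THEN conjunct1]
    and V = iter[rule_format, THEN conjunct2, THEN conjunct2, THEN conjunct2, THEN conjunct1]
    and aug = iter[rule_format, THEN conjunct2, THEN conjunct2, THEN conjunct2, THEN conjunct2]
  have dir1: "\<omega>h 1 = \<omega> + \<rho> *\<^sub>R (x0 - z)"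
    using dir[of 1] n start by simp
  have grow: "V0 \<subseteq> V t \<and> V t \<subseteq> V0 \<union> {v. v extreme_point_of (convex hull K)} \<and> (xh 1, yh 1) \<in> V t"
    if "1 \<le> t" "t \<le> n" for t
    using that
  proof (induction t rule: nat_induct_at_least)
    case base
    then show ?case
      using V[of 1] ext[of 1] start by (auto simp: is_arg_min_def)
  next
    case (Suc t)
    then show ?case
      using V[of "Suc t"] ext[of "Suc t"] by (auto simp: is_arg_min_def)
  qed
  show thesis
  proof (rule that)
    show "V0 \<subseteq> V'" "V' \<subseteq> V0 \<union> {v. v extreme_point_of (convex hull K)}" "(xh 1, yh 1) \<in> V'"
      using grow[of n] n result by auto
    show "is_arg_min (\<lambda>(u, v). (c + (\<omega> + \<rho> *\<^sub>R (x0 - z))) \<bullet> u + q \<bullet> v)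
       (\<lambda>v. v extreme_point_of (convex hull K)) (xh 1, yh 1)"
      using ext[of 1] n unfolding dir1 by simp
    show "\<phi> = (c + (\<omega> + \<rho> *\<^sub>R (x0 - z))) \<bullet> xh 1 + q \<bullet> yh 1"
      using result dir1 by simp
    show "is_arg_min (\<lambda>(u, v). aug_lagrangian c q \<rho> u v z \<omega>) (\<lambda>v. v \<in> convex hull V') (x', y')"
      using aug[of n] n result by simp
  qed
qed

lemma eventually_constant_finite_chain:
  fixes V :: "nat \<Rightarrow> 'a set"
  assumes "finite B" "\<And>k. V k \<subseteq> B" "\<And>k. V k \<subseteq> V (Suc k)"
  obtains N where "\<And>k. N \<le> k \<Longrightarrow> V k = V N"
proof -
  have "\<forall>k. card (V k) < Suc (card B)"
    using assms(1,2) by (simp add: card_mono less_Suc_eq_le)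
  then obtain N where N: "\<And>k. card (V k) \<le> card (V N)"
    using ex_has_greatest_nat[of "\<lambda>_. True" 0 "\<lambda>k. card (V k)" "Suc (card B)"] by auto
  have "V k = V N" if "N \<le> k" for k
  proof -
    have "V N \<subseteq> V k" using assms(3) that by (rule lift_Suc_mono_le)
    then show ?thesis
      using N[of k] assms(1,2) card_seteq[of "V k" "V N"] finite_subset by metis
  qed
  then show thesis by (rule that)
qed

section \<open>Convergence of the dual bounds\<close>

theorem proposition3:
  fixes p :: "'s::finite \<Rightarrow> real"
    and c :: "real ^ 'nx"
    and q :: "'s \<Rightarrow> real ^ 'ny"
    and X :: "(real ^ 'nx) set"
    and Y :: "'s \<Rightarrow> (real ^ 'ny) set"
    and W :: "'s \<Rightarrow> real ^ 'ny ^ 'm"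
    and T :: "'s \<Rightarrow> real ^ 'nx ^ 'm"
    and h :: "'s \<Rightarrow> real ^ 'm"
    and K :: "'s \<Rightarrow> ((real ^ 'nx) \<times> (real ^ 'ny)) set"
    and \<rho> \<alpha> :: real
    and tmax :: nat
    and V :: "nat \<Rightarrow> 's \<Rightarrow> ((real ^ 'nx) \<times> (real ^ 'ny)) set"
    and x :: "nat \<Rightarrow> 's \<Rightarrow> real ^ 'nx"
    and y :: "nat \<Rightarrow> 's \<Rightarrow> real ^ 'ny"
    and \<omega> :: "nat \<Rightarrow> 's \<Rightarrow> real ^ 'nx"
    and z :: "nat \<Rightarrow> real ^ 'nx"
    and \<phi>s :: "nat \<Rightarrow> 's \<Rightarrow> real"
    and \<phi> :: "nat \<Rightarrow> real"
  assumes p_pos: "\<And>s. p s > 0"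
    and p_sum: "(\<Sum>s\<in>UNIV. p s) = 1"
    and X_mil: "mixed_integer_linear X"
    and Y_mil: "\<And>s. mixed_integer_linear (Y s)"
    and K_def: "\<And>s. K s = scenario_set (W s) (T s) (h s) X (Y s)"
    and K_bounded: "\<And>s. bounded (convex hull (K s))"
    and optimal_exists: "\<exists>v. LD_optimal p c q K v"
    and V0_finite: "\<And>s. finite (V 0 s)"
    and V0_subset: "\<And>s. V 0 s \<subseteq> convex hull (K s)"
    and rho_pos: "\<rho> > 0"
    and tmax_pos: "tmax \<ge> 1"
    and omega0: "(\<Sum>s\<in>UNIV. p s *\<^sub>R \<omega> 0 s) = 0"
    and run: "FWPH_run p c q K \<rho> \<alpha> 0 \<infinity> tmax V x y \<omega> z \<phi>s \<phi>"
    and init: "tmax \<ge> 2 \<or> (\<Inter>s. fst ` (convex hull (V 0 s))) \<noteq> {}"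
  shows "\<phi> \<longlonglongrightarrow> zeta_LD p c q K"
proof -
  have p_nonneg: "p s \<ge> 0" for s using p_pos[of s] by simp
  have polytope_K: "polytope (convex hull (K s))" for s
  proof -
    obtain P I where PI: "polyhedron P" "finite I" "K s = P \<inter> {v. \<forall>i\<in>I. i \<bullet> v \<in> \<int>}"
      using scenario_set_mixed_integer[OF X_mil Y_mil[of s], where W = "W s" and T = "T s" and h = "h s"]
      unfolding K_def[of s, symmetric] by blast
    moreover have "bounded (K s)"
      using K_bounded[of s] by (meson bounded_subset hull_subset)
    ultimately show ?thesis
      using polytope_convex_hull_mixed_integer[of P I] by simp
  qed

  have never_stops: "\<not> FWPH_stop p 0 x z k" for k
    using p_nonneg by (simp add: FWPH_stop_def not_less sum_nonneg)
  note run_parts = run[unfolded FWPH_run_def]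
  have z0: "z 0 = (\<Sum>s\<in>UNIV. p s *\<^sub>R x 0 s)"
    and \<omega>1: "\<And>s. \<omega> 1 s = \<omega> 0 s + \<rho> *\<^sub>R (x 0 s - z 0)"
    using run_parts by blast+
  have iteration: "(\<forall>s. SDM c (q s) \<rho> (K s) (V k s) ((1 - \<alpha>) *\<^sub>R z k + \<alpha> *\<^sub>R x k s) (y k s)
               (\<omega> (Suc k) s) (z k) tmax 0 (x (Suc k) s, y (Suc k) s, V (Suc k) s, \<phi>s (Suc k) s))
     \<and> \<phi> (Suc k) = (\<Sum>s\<in>UNIV. p s * \<phi>s (Suc k) s)
     \<and> z (Suc k) = (\<Sum>s\<in>UNIV. p s *\<^sub>R x (Suc k) s)
     \<and> (\<forall>s. \<omega> (Suc (Suc k)) s = \<omega> (Suc k) s + \<rho> *\<^sub>R (x (Suc k) s - z (Suc k)))" for k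
    using run_parts[THEN conjunct2, THEN conjunct2, THEN spec, of "Suc k"] never_stops by simp
  note sdm = iteration[THEN conjunct1, THEN spec]
    and \<phi>_sum = iteration[THEN conjunct2, THEN conjunct1]
    and z_Suc = iteration[THEN conjunct2, THEN conjunct2, THEN conjunct1]
    and \<omega>_Suc = iteration[THEN conjunct2, THEN conjunct2, THEN conjunct2, THEN spec]
  have z_mean: "z k = (\<Sum>s\<in>UNIV. p s *\<^sub>R x k s)" for k
    using z0 z_Suc by (cases k) auto
  have spread: "(\<Sum>s\<in>UNIV. p s *\<^sub>R (x k s - z k)) = 0" for k
    using p_sum by (simp add: scaleR_diff_right sum_subtractf z_mean[of k] flip: scaleR_sum_left)
  have shifted_balanced: "(\<Sum>s\<in>UNIV. p s *\<^sub>R (\<mu> s + t *\<^sub>R (x k s - z k))) = 0"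
    if "(\<Sum>s\<in>UNIV. p s *\<^sub>R \<mu> s) = 0" for \<mu> t k
  proof -
    have "(\<Sum>s\<in>UNIV. p s *\<^sub>R (\<mu> s + t *\<^sub>R (x k s - z k)))
        = (\<Sum>s\<in>UNIV. p s *\<^sub>R \<mu> s) + t *\<^sub>R (\<Sum>s\<in>UNIV. p s *\<^sub>R (x k s - z k))"
      by (simp add: scaleR_add_right sum.distrib scaleR_sum_right mult.commute)
    then show ?thesis using that spread by simp
  qed
  have balanced: "(\<Sum>s\<in>UNIV. p s *\<^sub>R \<omega> (Suc k) s) = 0" for k
  proof (induction k)
    case 0
    then show ?case using shifted_balanced[OF omega0, of \<rho> 0] \<omega>1 by simp
  next
    case (Suc k)
    then show ?case using shifted_balanced[OF Suc, of \<rho> "Suc k"] by (simp add: \<omega>_Suc)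
  qed

  \<comment> \<open>The first inner iteration of pass \<open>Suc k\<close> minimises with first-stage cost vector \<open>c + \<Omega> k s\<close>.\<close>
  define \<Omega> where "\<Omega> k s = \<omega> (Suc k) s + (\<alpha> * \<rho>) *\<^sub>R (x k s - z k)" for k s
  have start_direction: "\<omega> (Suc k) s + \<rho> *\<^sub>R ((1 - \<alpha>) *\<^sub>R z k + \<alpha> *\<^sub>R x k s - z k) = \<Omega> k s" for k s
    by (simp add: \<Omega>_def algebra_simps)
  have \<Omega>_balanced: "(\<Sum>s\<in>UNIV. p s *\<^sub>R \<Omega> k s) = 0" for k
    unfolding \<Omega>_def using shifted_balanced[OF balanced] by simp
  \<comment> \<open>One extreme point per pass and scenario, with all that the pass guarantees about it.\<close>
  define step_point where "step_point k s e \<longleftrightarrow> V k s \<subseteq> V (Suc k) s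
      \<and> V (Suc k) s \<subseteq> V k s \<union> {v. v extreme_point_of (convex hull (K s))} \<and> e \<in> V (Suc k) s
      \<and> is_arg_min (\<lambda>(u, v). (c + \<Omega> k s) \<bullet> u + q s \<bullet> v) (\<lambda>v. v extreme_point_of (convex hull (K s))) e
      \<and> \<phi>s (Suc k) s = (c + \<Omega> k s) \<bullet> fst e + q s \<bullet> snd e
      \<and> is_arg_min (\<lambda>(u, v). aug_lagrangian c (q s) \<rho> u v (z k) (\<omega> (Suc k) s))
          (\<lambda>v. v \<in> convex hull (V (Suc k) s)) (x (Suc k) s, y (Suc k) s)" for k s e
  have "\<exists>e. step_point k s e" for k s
  proof (rule SDM_result[OF sdm[of s k], unfolded start_direction])
    fix u v
    assume "V k s \<subseteq> V (Suc k) s" "V (Suc k) s \<subseteq> V k s \<union> {v. v extreme_point_of (convex hull (K s))}"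
      "(u, v) \<in> V (Suc k) s"
      "is_arg_min (\<lambda>(u, v). (c + \<Omega> k s) \<bullet> u + q s \<bullet> v) (\<lambda>v. v extreme_point_of (convex hull (K s))) (u, v)"
      "\<phi>s (Suc k) s = (c + \<Omega> k s) \<bullet> u + q s \<bullet> v"
      "is_arg_min (\<lambda>(u, v). aug_lagrangian c (q s) \<rho> u v (z k) (\<omega> (Suc k) s))
          (\<lambda>v. v \<in> convex hull (V (Suc k) s)) (x (Suc k) s, y (Suc k) s)"
    then have "step_point k s (u, v)"
      unfolding step_point_def fst_conv snd_conv by (intro conjI)
    then show ?thesis ..
  qed
  then obtain e where e: "\<And>k s. step_point k s (e k s)" by metis
  note V_grow = e[unfolded step_point_def, THEN conjunct1]
    and V_new = e[unfolded step_point_def, THEN conjunct2, THEN conjunct1]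
    and e_V = e[unfolded step_point_def, THEN conjunct2, THEN conjunct2, THEN conjunct1]
    and e_min = e[unfolded step_point_def, THEN conjunct2, THEN conjunct2, THEN conjunct2, THEN conjunct1]
    and \<phi>s_eq = e[unfolded step_point_def, THEN conjunct2, THEN conjunct2, THEN conjunct2, THEN conjunct2,
        THEN conjunct1]
    and x_min = e[unfolded step_point_def, THEN conjunct2, THEN conjunct2, THEN conjunct2, THEN conjunct2,
        THEN conjunct2]

  obtain xo yo zo where opt: "LD_optimal p c q K (xo, yo, zo)"
    using optimal_exists by (metis prod_cases3)
  then have feasible: "(xo, yo, zo) \<in> LD_feasible K"
    and minimal: "\<And>v. v \<in> LD_feasible K \<Longrightarrow> LD_objective p c q (xo, yo, zo) \<le> LD_objective p c q v"
    by (auto simp: LD_optimal_def is_arg_min_linorder)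
  have zeta: "zeta_LD p c q K = LD_objective p c q (xo, yo, zo)"
    unfolding zeta_LD_def using feasible minimal by (intro cInf_eq_minimum) auto
  have zeta_le: "zeta_LD p c q K \<le> LD_objective p c q v" if "v \<in> LD_feasible K" for v
    using minimal[OF that] zeta by simp

  \<comment> \<open>\<open>\<Omega> k\<close> has mean 0, so it contributes nothing at a consensus point.\<close>
  have weak_duality: "\<phi> (Suc k) \<le> zeta_LD p c q K" for k
  proof -
    have at_zo: "xo s = zo" "(zo, yo s) \<in> convex hull (K s)" for s
      using feasible by (auto simp: LD_feasible_def)
    have "\<phi>s (Suc k) s \<le> (c + \<Omega> k s) \<bullet> zo + q s \<bullet> yo s" for s
      unfolding \<phi>s_eq
      by (rule extreme_point_minimizer[OF polytope_imp_compact[OF polytope_K[of s]] convex_convex_hull])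
        (use e_min[of k s] at_zo in auto)
    then have "\<phi> (Suc k) \<le> (\<Sum>s\<in>UNIV. p s * ((c + \<Omega> k s) \<bullet> zo + q s \<bullet> yo s))"
      unfolding \<phi>_sum using p_nonneg by (intro sum_mono mult_left_mono)
    also have "\<dots> = zeta_LD p c q K + (\<Sum>s\<in>UNIV. p s *\<^sub>R \<Omega> k s) \<bullet> zo"
      by (simp add: zeta LD_objective_def at_zo inner_sum_left inner_add_left algebra_simps sum.distrib)
    finally show ?thesis by (simp add: \<Omega>_balanced)
  qed

  have V_bound: "V k s \<subseteq> V 0 s \<union> {v. v extreme_point_of (convex hull (K s))}" for k s
    using V_new by (induction k) blast+
  have finite_bound: "finite (V 0 s \<union> {v. v extreme_point_of (convex hull (K s))})" for s
    using V0_finite polytope_K by (simp add: finite_polyhedron_extreme_points polytope_imp_polyhedron)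
  have "\<exists>N. \<forall>k\<ge>N. V k s = V N s" for s
    using eventually_constant_finite_chain[OF finite_bound[of s], of "\<lambda>k. V k s"] V_bound V_grow by metis
  then obtain N where N: "\<And>s k. N s \<le> k \<Longrightarrow> V k s = V (N s) s" by metis
  define M where "M = Max (range N)"
  have V_const: "V (M + k) s = V M s" for k s
  proof -
    have "N s \<le> M" by (simp add: M_def)
    then show ?thesis using N[of s "M + k"] N[of s M] by simp
  qed
  define C where "C s = convex hull (V M s)" for s
  have C_subset: "C s \<subseteq> convex hull (K s)" for s
    unfolding C_def using V_bound[of M s] V0_subset[of s]
    by (intro hull_minimal) (auto simp: extreme_point_of_def)
  define Wset where "Wset = {w :: ((real ^ 'nx) \<times> (real ^ 'ny)) ^ 's. \<forall>s. w $ s \<in> C s}"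
  have "polytope (C s)" for s
    unfolding C_def using finite_subset[OF V_bound finite_bound] by (rule polytope_convex_hull)
  then have Wset: "polytope Wset"
    unfolding Wset_def by (rule polytope_vec)
  \<comment> \<open>The run from pass \<open>Suc M\<close> on, as an alternating direction method over \<open>Wset\<close>. The point \<open>g k\<close>
    comes from the pass after the one of \<open>w k\<close>, because its objective uses the multiplier updated with \<open>w k\<close>.\<close>
  define w where "w k = (\<chi> s. (x (Suc (M + k)) s, y (Suc (M + k)) s))" for k
  define g where "g k = (\<chi> s. e (Suc (M + k)) s)" for k
  define U where "U k = weighted p (\<omega> (Suc (M + k)))" for k
  have V_Suc: "V (Suc (M + k)) s = V M s" for k s
    using V_const[of "Suc k" s] by simp
  have w_min: "is_arg_min (\<lambda>(u, v). aug_lagrangian c (q s) \<rho> u v (z (M + k)) (\<omega> (Suc (M + k)) s))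
          (\<lambda>v. v \<in> C s) (x (Suc (M + k)) s, y (Suc (M + k)) s)" for k s
    using x_min[of s "M + k"] by (simp add: C_def V_Suc)
  have w_mem: "w k \<in> Wset" for k
    using w_min by (simp add: Wset_def w_def is_arg_min_def)
  have g_mem: "g k \<in> Wset" for k
    using e_V[of "Suc (M + k)"] V_Suc[of "Suc k"] by (simp add: Wset_def g_def C_def hull_inc)
  have centre: "z (Suc (M + k)) = mean_first p (w k)" for k
    by (simp add: z_Suc mean_first_def w_def)
  have deviation_w: "deviation p (w k) = weighted p (\<lambda>s. x (Suc (M + k)) s - z (Suc (M + k)))" for k
    unfolding deviation_def centre[symmetric] by (simp add: w_def)
  have multiplier: "U (Suc k) = U k + \<rho> *\<^sub>R deviation p (w k)" for k
    unfolding U_def deviation_w weighted_add[symmetric]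
    by (intro arg_cong[where f = "weighted p"] ext) (simp add: \<omega>_Suc)
  \<comment> \<open>Adding the change of the centre to the updated multiplier gives the gradient of the augmented
    Lagrangian at \<open>x (Suc (M + k)) s\<close>.\<close>
  have scenario_sum: "total_cost p c q v + U (Suc k) \<bullet> deviation p v
          + \<rho> * ((z (M + Suc k) - z (M + k)) \<bullet> mean_first p v)
      = (\<Sum>s\<in>UNIV. p s * ((c + \<omega> (Suc (M + k)) s + \<rho> *\<^sub>R (x (Suc (M + k)) s - z (M + k))) \<bullet> fst (v $ s)
           + q s \<bullet> snd (v $ s)))" for k v
  proof -
    have eta: "c + \<omega> (Suc (M + Suc k)) s + \<rho> *\<^sub>R (z (M + Suc k) - z (M + k))
        = c + \<omega> (Suc (M + k)) s + \<rho> *\<^sub>R (x (Suc (M + k)) s - z (M + k))" for s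
      by (simp add: \<omega>_Suc algebra_simps)
    show ?thesis
      using lagrangian_as_scenario_sum[OF p_nonneg balanced[of "M + Suc k"], of c q v
        "\<rho> *\<^sub>R (z (M + Suc k) - z (M + k))"]
      unfolding eta U_def by simp
  qed
  have variational: "total_cost p c q (w k) + U (Suc k) \<bullet> deviation p (w k)
          + \<rho> * ((z (M + Suc k) - z (M + k)) \<bullet> mean_first p (w k))
      \<le> total_cost p c q v + U (Suc k) \<bullet> deviation p v
          + \<rho> * ((z (M + Suc k) - z (M + k)) \<bullet> mean_first p v)" if "v \<in> Wset" for k v
    unfolding scenario_sum
  proof (intro sum_mono mult_left_mono p_nonneg)
    fix s
    have "(fst (v $ s), snd (v $ s)) \<in> C s" using that by (simp add: Wset_def)
    from augmented_lagrangian_minimizer_variational[OF _ rho_pos w_min this]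
    show "(c + \<omega> (Suc (M + k)) s + \<rho> *\<^sub>R (x (Suc (M + k)) s - z (M + k))) \<bullet> fst (w k $ s) + q s \<bullet> snd (w k $ s)
        \<le> (c + \<omega> (Suc (M + k)) s + \<rho> *\<^sub>R (x (Suc (M + k)) s - z (M + k))) \<bullet> fst (v $ s) + q s \<bullet> snd (v $ s)"
      by (simp add: w_def C_def)
  qed
  have dual: "\<phi> (Suc (Suc (M + k))) = total_cost p c q (g k)
      + (U (Suc k) + (\<alpha> * \<rho>) *\<^sub>R deviation p (w k)) \<bullet> deviation p (g k)" for k
  proof -
    have "weighted p (\<Omega> (Suc (M + k))) = U (Suc k) + (\<alpha> * \<rho>) *\<^sub>R deviation p (w k)"
      unfolding U_def deviation_w weighted_add[symmetric]
      by (intro arg_cong[where f = "weighted p"] ext) (simp add: \<Omega>_def)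
    with lagrangian_as_scenario_sum[OF p_nonneg \<Omega>_balanced[of "Suc (M + k)"], of c q "g k" 0]
    show ?thesis by (simp add: \<phi>_sum \<phi>s_eq g_def)
  qed

  obtain v err where v: "v \<in> Wset" "deviation p v = 0" and err: "err \<longlonglongrightarrow> 0"
    "\<And>k. total_cost p c q v + err k \<le> \<phi> (Suc (Suc (M + k)))"
    by (rule alternating_direction_dual_values[where w = w and g = g and U = U
          and Z = "\<lambda>k. z (M + k)" and \<theta> = "\<lambda>k. \<phi> (Suc (Suc (M + k)))" and B = "zeta_LD p c q K",
          OF Wset linear_total_cost linear_deviation linear_mean_first rho_pos w_mem g_mem multiplier
            _ variational dual weak_duality])
      (simp add: centre, assumption, rule that)
  have consensus: "fst (v $ s) = mean_first p v" for s
  proof -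
    have "deviation p v $ s = 0" using v(2) by simp
    then show ?thesis using p_pos[of s] by (simp add: deviation_def weighted_def)
  qed
  have "(mean_first p v, snd (v $ s)) \<in> convex hull (K s)" for s
  proof -
    have "(mean_first p v, snd (v $ s)) = v $ s"
      using consensus by (simp add: prod_eq_iff)
    then show ?thesis using v(1) C_subset by (auto simp: Wset_def)
  qed
  then have "((\<lambda>s. fst (v $ s)), (\<lambda>s. snd (v $ s)), mean_first p v) \<in> LD_feasible K"
    by (simp add: LD_feasible_def consensus)
  from zeta_le[OF this] have "zeta_LD p c q K \<le> total_cost p c q v"
    by (simp add: LD_objective_def total_cost_def)
  then have "zeta_LD p c q K + err k \<le> \<phi> (k + Suc (Suc M))" for k
    using err(2)[of k] by (simp add: add.commute)
  moreover have "(\<lambda>k. zeta_LD p c q K + err k) \<longlonglongrightarrow> zeta_LD p c q K"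
    using tendsto_add[OF tendsto_const err(1)] by simp
  moreover have "\<phi> (k + Suc (Suc M)) \<le> zeta_LD p c q K" for k
    using weak_duality[of "k + Suc M"] by simp
  ultimately have "(\<lambda>k. \<phi> (k + Suc (Suc M))) \<longlonglongrightarrow> zeta_LD p c q K"
    by (intro tendsto_sandwich[where g = "\<lambda>k. \<phi> (k + Suc (Suc M))"
        and f = "\<lambda>k. zeta_LD p c q K + err k" and h = "\<lambda>_. zeta_LD p c q K"]) auto
  then show ?thesis by (rule LIMSEQ_offset)
qed
end
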